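(* The Banach space $C[0,1]$ fails property $(D_\infty)$. That is, it is not true that every $L_\infty(C[0,1])$-bounded sequence of functions that converges scalarly in measure (to some $f\in L_0(C[0,1])$) has a subsequence that converges scalarly a.e.
   Context: $(\Omega,\Sigma,\mu)$ is the Lebesgue measure space on $[0,1]$. Banach spaces are real; $C[0,1]$ is the space of continuous real functions on $[0,1]$ with the sup norm. For a Banach space $X$, $L_0(X)$ is the space of (classes of a.e. equal) strongly measurable functions $f:\Omega\to X$, and $L_\infty(X)$ is the space of essentially bounded ones. For $f_n,f\in L_0(X)$, $\{f_n\}$ converges scalarly a.e. (resp. scalarly in measure) to $f$ if for each $x^*\in X^*$, $x^*f_n\to x^*f$ almost everywhere, with exceptional null set possibly depending on $x^*$ (resp. in measure). A sequence is $L_\infty(X)$-bounded if $\sup_n\|f_n\|_{L_\infty(X)}<\infty$. *)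

theory Defs
  imports "HOL-Analysis.Analysis" "HOL-Probability.Essential_Supremum"
begin

section \<open>The Banach space of continuous functions on the unit interval\<close>

text \<open>The library type of bounded continuous functions has a type as its domain, so the
  interval is made a type; it carries the metric of the real line. Since it is compact,
  bounded continuous functions on it are just the continuous ones.\<close>

typedef unit_interval = "{0..1::real}"
  by (rule exI[of _ 0]) simp

instantiation unit_interval :: metric_space
begin

definition dist_unit_interval :: "unit_interval \<Rightarrow> unit_interval \<Rightarrow> real"
  where "dist_unit_interval s t = dist (Rep_unit_interval s) (Rep_unit_interval t)"

definition uniformity_unit_interval :: "(unit_interval \<times> unit_interval) filter"
  where "uniformity_unit_interval = (INF e\<in>{0<..}. principal {(s, t). dist s t < e})"

definition open_unit_interval :: "unit_interval set \<Rightarrow> bool"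
  where "open_unit_interval U = (\<forall>s\<in>U. \<forall>\<^sub>F (s', t) in uniformity. s' = s \<longrightarrow> t \<in> U)"

instance
  by standard
    (auto simp: dist_unit_interval_def uniformity_unit_interval_def open_unit_interval_def
        Rep_unit_interval_inject dist_triangle2)

end

instance bcontfun :: (metric_space, banach) banach ..

type_synonym C01 = "unit_interval \<Rightarrow>\<^sub>C real"

lemma continuous_on_Rep_unit_interval: "continuous_on UNIV Rep_unit_interval"
  unfolding continuous_on_iff by (auto simp: dist_unit_interval_def)

lemma continuous_on_Abs_unit_interval: "continuous_on {0..1} Abs_unit_interval"
  unfolding continuous_on_iff by (auto simp: dist_unit_interval_def Abs_unit_interval_inverse)

lemma range_Abs_unit_interval: "Abs_unit_interval ` {0..1} = UNIV"
  using type_definition.Abs_image[OF type_definition_unit_interval] .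

lemma compact_unit_interval: "compact (UNIV :: unit_interval set)"
  using compact_continuous_image[OF continuous_on_Abs_unit_interval]
  by (simp add: range_Abs_unit_interval)

lemma C01_ex1:
  assumes "continuous_on {0..1::real} g"
  shows "\<exists>!h :: C01. \<forall>t\<in>{0..1}. h (Abs_unit_interval t) = g t"
proof -
  let ?k = "\<lambda>s. g (Rep_unit_interval s)"
  have cont: "continuous_on UNIV ?k"
    using continuous_on_compose2[OF assms continuous_on_Rep_unit_interval] Rep_unit_interval
    by blast
  then have "bounded (range ?k)"
    by (intro compact_imp_bounded compact_continuous_image compact_unit_interval)
  with cont have "?k \<in> bcontfun"
    by (simp add: bcontfun_def)
  then have "\<forall>t\<in>{0..1}. Bcontfun ?k (Abs_unit_interval t) = g t"
    by (simp add: Bcontfun_inverse Abs_unit_interval_inverse)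
  moreover have "h = h'"
    if "\<forall>t\<in>{0..1}. h (Abs_unit_interval t) = g t" "\<forall>t\<in>{0..1}. h' (Abs_unit_interval t) = g t"
    for h h' :: C01
    using that by (intro bcontfun_eqI) (metis Abs_unit_interval_cases)
  ultimately show ?thesis
    by blast
qed

lemma C01_continuous_on: "continuous_on {0..1} (\<lambda>t. (h :: C01) (Abs_unit_interval t))"
  by (rule continuous_on_compose2[OF _ continuous_on_Abs_unit_interval, of UNIV]) auto

lemma C01_norm: "norm (h :: C01) = (SUP t\<in>{0..1}. \<bar>h (Abs_unit_interval t)\<bar>)"
proof -
  have "norm h = (SUP s. \<bar>h s\<bar>)"
    by (simp add: norm_bcontfun_def dist_bcontfun.rep_eq)
  also have "\<dots> = (SUP t\<in>{0..1}. \<bar>h (Abs_unit_interval t)\<bar>)"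
    by (simp flip: range_Abs_unit_interval add: image_image)
  finally show ?thesis .
qed

section \<open>Vector-valued measurable functions and scalar convergence\<close>

text \<open>Classes of a.e. equal functions are handled through their representatives; all notions
  below are invariant under a.e. equality.\<close>

abbreviation leb01 :: "real measure"
  where "leb01 \<equiv> lebesgue_on {0..1}"

definition strongly_measurable :: "'m measure \<Rightarrow> ('m \<Rightarrow> 'a::real_normed_vector) \<Rightarrow> bool"
  where "strongly_measurable M f \<longleftrightarrow>
    (\<exists>s. (\<forall>n::nat. simple_function M (s n)) \<and> (AE t in M. (\<lambda>n. s n t) \<longlonglongrightarrow> f t))"

definition L0 :: "(real \<Rightarrow> 'a::real_normed_vector) set"
  where "L0 = {f. strongly_measurable leb01 f}"

definition Linf_norm :: "(real \<Rightarrow> 'a::real_normed_vector) \<Rightarrow> ereal"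
  where "Linf_norm f = esssup leb01 (\<lambda>t. ereal (norm (f t)))"

definition Linf :: "(real \<Rightarrow> 'a::real_normed_vector) set"
  where "Linf = {f \<in> L0. Linf_norm f < \<infinity>}"

definition Linf_bounded :: "(nat \<Rightarrow> real \<Rightarrow> 'a::real_normed_vector) \<Rightarrow> bool"
  where "Linf_bounded f \<longleftrightarrow> (\<forall>n. f n \<in> Linf) \<and> (SUP n. Linf_norm (f n)) < \<infinity>"

definition converges_in_measure ::
    "'m measure \<Rightarrow> (nat \<Rightarrow> 'm \<Rightarrow> real) \<Rightarrow> ('m \<Rightarrow> real) \<Rightarrow> bool"
  where "converges_in_measure M g h \<longleftrightarrow>
    (\<forall>e>0. (\<lambda>n. measure M {t \<in> space M. \<bar>g n t - h t\<bar> > e}) \<longlonglongrightarrow> 0)"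

definition converges_scalarly_ae ::
    "(nat \<Rightarrow> real \<Rightarrow> 'a::real_normed_vector) \<Rightarrow> (real \<Rightarrow> 'a) \<Rightarrow> bool"
  where "converges_scalarly_ae f g \<longleftrightarrow>
    (\<forall>\<phi> :: 'a \<Rightarrow>\<^sub>L real. AE t in leb01. (\<lambda>n. \<phi> (f n t)) \<longlonglongrightarrow> \<phi> (g t))"

definition converges_scalarly_in_measure ::
    "(nat \<Rightarrow> real \<Rightarrow> 'a::real_normed_vector) \<Rightarrow> (real \<Rightarrow> 'a) \<Rightarrow> bool"
  where "converges_scalarly_in_measure f g \<longleftrightarrow>
    (\<forall>\<phi> :: 'a \<Rightarrow>\<^sub>L real. converges_in_measure leb01 (\<lambda>n t. \<phi> (f n t)) (\<lambda>t. \<phi> (g t)))"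

text \<open>The scalar a.e. limit of the subsequence is not required to be the given limit in measure,
  but any such limit agrees with it a.e.\<close>

definition property_D_inf :: "'a::banach itself \<Rightarrow> bool"
  where "property_D_inf _ \<longleftrightarrow>
    (\<forall>f :: nat \<Rightarrow> real \<Rightarrow> 'a.
      Linf_bounded f \<and> (\<exists>g\<in>L0. converges_scalarly_in_measure f g) \<longrightarrow>
      (\<exists>r :: nat \<Rightarrow> nat. strict_mono r \<and> (\<exists>h\<in>L0. converges_scalarly_ae (f \<circ> r) h)))"

end

theory Submission
  imports Defs "HOL-Library.Discrete_Functions"
begin

text \<open>On the dyadic intervals of length \<open>1 / 2 ^ n\<close> the function \<open>fseq n\<close> is constant, with values
  in \<open>[0, 1]\<close>-valued continuous functions \<open>piece n i\<close>, \<open>i < 2 ^ n\<close>. Before truncation these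
  are independent coordinates: every 0-1 array is realized at some point \<open>u\<close> of the interval.
  The truncation makes the averages of \<open>piece n i u\<close> over \<open>i\<close> square summable in \<open>n\<close>, uniformly
  in \<open>u\<close>. By Cauchy--Schwarz, for a functional \<open>\<phi>\<close> the averages of \<open>\<bar>\<phi> (piece n i)\<bar>\<close> are then
  square summable too (so no Riesz representation is needed), which gives convergence to 0 in
  measure. On the other hand, along any subsequence the array of a typewriter sequence, with averages
  at most \<open>2 / k\<close>, survives the truncation; evaluation at its point is a functional for which
  the subsequence diverges everywhere on \<open>[0, 1)\<close>.\<close>

section \<open>Weakly null sequences\<close>

text \<open>Duality: \<open>\<phi>\<close> is tested on the sum of the \<open>g n\<close> weighted
  by \<open>\<phi> (g n)\<close>. Its value there is \<open>?T\<^sup>2\<close>, while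
  Cauchy--Schwarz at each point bounds the sup norm by \<open>?T * sqrt C\<close>; cancelling
  \<open>?T\<close> bounds the partial sums independently of \<open>N\<close>.\<close>

lemma blinfun_square_summable:
  fixes g :: "nat \<Rightarrow> ('a::metric_space \<Rightarrow>\<^sub>C real)" and \<phi> :: "('a \<Rightarrow>\<^sub>C real) \<Rightarrow>\<^sub>L real"
  assumes C: "\<And>N u. (\<Sum>n<N. (g n u)\<^sup>2) \<le> C"
  shows "summable (\<lambda>n. (\<phi> (g n))\<^sup>2)"
proof (rule summableI_nonneg_bounded)
  fix N
  let ?a = "\<lambda>n. \<phi> (g n)"
  let ?T = "L2_set ?a {..<N}"
  have C0: "0 \<le> C"
    using C[where N = 0] by simp
  have ev: "(\<Sum>n<M. ?a n *\<^sub>R g n) u = (\<Sum>n<M. ?a n * g n u)" for M u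
    by (induction M) simp_all
  have "norm (\<Sum>n<N. ?a n *\<^sub>R g n) \<le> ?T * sqrt C"
  proof (rule norm_bound)
    fix u
    have "\<bar>\<Sum>n<N. ?a n * g n u\<bar> \<le> (\<Sum>n<N. \<bar>?a n\<bar> * \<bar>g n u\<bar>)"
      by (rule order_trans[OF sum_abs]) (simp add: abs_mult)
    also have "\<dots> \<le> ?T * L2_set (\<lambda>n. g n u) {..<N}"
      by (rule L2_set_mult_ineq)
    also have "\<dots> \<le> ?T * sqrt C"
      using C by (intro mult_left_mono) (auto simp: L2_set_def sum_nonneg)
    finally show "norm ((\<Sum>n<N. ?a n *\<^sub>R g n) u) \<le> ?T * sqrt C"
      by (simp add: ev)
  qed
  then have "norm \<phi> * norm (\<Sum>n<N. ?a n *\<^sub>R g n) \<le> norm \<phi> * (?T * sqrt C)"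
    by (simp add: mult_left_mono)
  moreover have "?T\<^sup>2 = \<phi> (\<Sum>n<N. ?a n *\<^sub>R g n)"
    by (simp add: L2_set_def sum_nonneg blinfun.sum_right blinfun.scaleR_right power2_eq_square)
  ultimately have T: "?T\<^sup>2 \<le> norm \<phi> * sqrt C * ?T"
    using norm_blinfun[of \<phi> "\<Sum>n<N. ?a n *\<^sub>R g n"] by (simp add: mult_ac)
  have "?T \<le> norm \<phi> * sqrt C"
  proof (cases "?T = 0")
    case True
    with C0 show ?thesis
      by simp
  next
    case False
    then have "?T > 0"
      by (simp add: less_le)
    with T show ?thesis
      by (simp add: power2_eq_square)
  qed
  then have "?T\<^sup>2 \<le> (norm \<phi> * sqrt C)\<^sup>2"
    by (simp add: power_mono)
  then show "(\<Sum>n<N. (?a n)\<^sup>2) \<le> (norm \<phi> * sqrt C)\<^sup>2"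
    by (simp add: L2_set_def sum_nonneg)
qed simp

lemma blinfun_tendsto_0_if_square_bounded:
  fixes g :: "nat \<Rightarrow> ('a::metric_space \<Rightarrow>\<^sub>C real)" and \<phi> :: "('a \<Rightarrow>\<^sub>C real) \<Rightarrow>\<^sub>L real"
  assumes "\<And>N u. (\<Sum>n<N. (g n u)\<^sup>2) \<le> C"
  shows "(\<lambda>n. \<phi> (g n)) \<longlonglongrightarrow> 0"
proof -
  have "(\<lambda>n. (\<phi> (g n))\<^sup>2) \<longlonglongrightarrow> 0"
    by (rule summable_LIMSEQ_zero[OF blinfun_square_summable[OF assms]])
  then have "(\<lambda>n. sqrt ((\<phi> (g n))\<^sup>2)) \<longlonglongrightarrow> sqrt 0"
    by (rule tendsto_real_sqrt)
  then show ?thesis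
    by (simp add: tendsto_rabs_zero_iff)
qed

lemma bounded_linear_apply_bcontfun:
  "bounded_linear (\<lambda>g :: 'a::metric_space \<Rightarrow>\<^sub>C 'b::real_normed_vector. g u)"
  by (rule bounded_linear_intro[of _ 1]) (simp_all add: norm_bounded)

section \<open>Coding binary sequences by points of the interval\<close>

text \<open>A continuous reader of ternary digits: the cosine passes 1/2 at 1/3 and -1/2 at 2/3, so
  clipping separates the outer thirds of the unit interval. Its period 2 makes even integers
  invisible.\<close>

definition bump :: "real \<Rightarrow> real"
  where "bump x = max 0 (min 1 (1 / 2 - cos (pi * x)))"

lemma bump_bounds: "0 \<le> bump x" "bump x \<le> 1"
  by (auto simp: bump_def)

lemma continuous_on_bump [continuous_intros]:
  fixes f :: "'a::t2_space \<Rightarrow> real"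
  shows "continuous_on S f \<Longrightarrow> continuous_on S (\<lambda>x. bump (f x))"
  unfolding bump_def by (intro continuous_intros)

lemma bump_eq_0: "0 \<le> x \<Longrightarrow> x \<le> 1 / 3 \<Longrightarrow> bump x = 0"
  using cos_monotone_0_pi_le[of "pi * x" "pi / 3"] pi_gt_zero
  by (simp add: bump_def cos_60 field_simps)

lemma bump_eq_1:
  assumes "2 / 3 \<le> x" "x \<le> 1"
  shows "bump x = 1"
proof -
  have "cos (pi * x) \<le> cos (pi * (2 / 3))"
    using assms by (intro cos_monotone_0_pi_le) auto
  then have "cos (pi * x) \<le> - 1 / 2"
    using cos_120 by (simp add: mult.commute)
  then show ?thesis
    by (simp add: bump_def)
qed

lemma bump_plus_even: "bump (real (2 * n) + x) = bump x"
proof -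
  have "pi * (real (2 * n) + x) = pi * x + 2 * real n * pi"
    by (simp add: algebra_simps)
  then have "cos (pi * (real (2 * n) + x)) = cos (pi * x)"
    by (simp only: cos_add cos_2npi sin_2npi mult_1_right mult_zero_right diff_zero)
  then show ?thesis
    by (simp add: bump_def)
qed

text \<open>The point of the Cantor set with ternary digits 0 and 2 prescribed by
  \<open>\<beta>\<close>.\<close>

definition cantor_point :: "(nat \<Rightarrow> bool) \<Rightarrow> real"
  where "cantor_point \<beta> = (\<Sum>m. 2 * of_bool (\<beta> m) / 3 ^ Suc m)"

lemma cantor_point_summable: "summable (\<lambda>m. 2 * of_bool (\<beta> m) / 3 ^ Suc m :: real)"
proof (rule summable_comparison_test'[where N = 0])
  show "summable (\<lambda>m. 2 / 3 * (1 / 3) ^ m :: real)"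
    by (intro summable_mult summable_geometric) simp
qed (auto simp: of_bool_def field_simps)

lemma cantor_point_bounds: "0 \<le> cantor_point \<beta>" "cantor_point \<beta> \<le> 1"
proof -
  show "0 \<le> cantor_point \<beta>"
    unfolding cantor_point_def by (intro suminf_nonneg cantor_point_summable) auto
  have s: "(\<lambda>m. 2 / 3 * (1 / 3) ^ m :: real) sums (2 / 3 * (1 / (1 - 1 / 3)))"
    by (intro sums_mult geometric_sums) simp
  have "cantor_point \<beta> \<le> (\<Sum>m. 2 / 3 * (1 / 3) ^ m)"
    unfolding cantor_point_def
    by (intro suminf_le cantor_point_summable sums_summable[OF s])
      (auto simp: of_bool_def field_simps)
  also have "\<dots> = 1"
    using sums_unique[OF s] by simp
  finally show "cantor_point \<beta> \<le> 1" .
qed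

lemma cantor_point_rec: "3 * cantor_point \<beta> = 2 * of_bool (\<beta> 0) + cantor_point (\<beta> \<circ> Suc)"
proof -
  have "3 * cantor_point \<beta> = 3 * ((\<Sum>m. 2 * of_bool (\<beta> (Suc m)) / 3 ^ Suc (Suc m)) + 2 * of_bool (\<beta> 0) / 3)"
    unfolding cantor_point_def using suminf_split_head[OF cantor_point_summable[of \<beta>]] by simp
  also have "(\<Sum>m. 2 * of_bool (\<beta> (Suc m)) / 3 ^ Suc (Suc m)) = cantor_point (\<beta> \<circ> Suc) / 3"
    unfolding cantor_point_def
    by (subst suminf_divide[OF cantor_point_summable, symmetric]) (simp add: mult_ac)
  finally show ?thesis
    by simp
qed

text \<open>Multiplication by \<open>3 ^ m\<close> shifts the ternary expansion. The digits moved
  before the point are 0 or 2, so they form an even integer, which \<open>bump\<close> ignores; the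
  next digit decides between the two outer thirds.\<close>

lemma bump_cantor_point: "bump (3 ^ m * cantor_point \<beta>) = of_bool (\<beta> m)"
proof (induction m arbitrary: \<beta>)
  case 0
  show ?case
    using cantor_point_rec[of \<beta>] cantor_point_bounds[of "\<beta> \<circ> Suc"]
    by (cases "\<beta> 0") (auto intro!: bump_eq_0 bump_eq_1)
next
  case (Suc m)
  have "3 ^ Suc m * cantor_point \<beta> = 3 ^ m * (3 * cantor_point \<beta>)"
    by simp
  also have "\<dots> = real (2 * (3 ^ m * of_bool (\<beta> 0))) + 3 ^ m * cantor_point (\<beta> \<circ> Suc)"
    unfolding cantor_point_rec by (simp add: algebra_simps)
  finally show ?case
    using Suc[of "\<beta> \<circ> Suc"] by (simp only: bump_plus_even) simp
qed

section \<open>The sequence\<close>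

text \<open>The pairing arranges the digits of one point in a doubly indexed array, so that all
  coordinates can be prescribed independently.\<close>

definition coord :: "nat \<Rightarrow> nat \<Rightarrow> real \<Rightarrow> real"
  where "coord n i x = bump (3 ^ prod_encode (n, i) * x)"

definition density :: "nat \<Rightarrow> real \<Rightarrow> real"
  where "density n x = (\<Sum>i<2 ^ n. coord n i x) / 2 ^ n"

text \<open>As soon as the square sum of the densities at a point reaches 10, the cutoff vanishes; it
  is 1 at all points where the square sum never exceeds 9.\<close>

definition cutoff :: "nat \<Rightarrow> real \<Rightarrow> real"
  where "cutoff n x = max 0 (min 1 (10 - (\<Sum>m\<le>n. (density m x)\<^sup>2)))"

text \<open>On the unit interval the default 0 is met by \<open>fseq n\<close> only at
  \<open>t = 1\<close>, where the index is \<open>2 ^ n\<close>.\<close>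

definition piece :: "nat \<Rightarrow> nat \<Rightarrow> C01"
  where "piece n i =
    (if i < 2 ^ n then Bcontfun (\<lambda>u. cutoff n (Rep_unit_interval u) * coord n i (Rep_unit_interval u))
     else 0)"

definition fseq :: "nat \<Rightarrow> real \<Rightarrow> C01"
  where "fseq n t = piece n (nat \<lfloor>2 ^ n * t\<rfloor>)"

lemma coord_bounds: "0 \<le> coord n i x" "coord n i x \<le> 1"
  by (simp_all add: coord_def bump_bounds)

lemma cutoff_bounds: "0 \<le> cutoff n x" "cutoff n x \<le> 1"
  by (simp_all add: cutoff_def)

lemma density_nonneg: "0 \<le> density n x"
  by (simp add: density_def sum_nonneg coord_bounds)

lemma piece_apply:
  assumes "i < 2 ^ n"
  shows "piece n i u = cutoff n (Rep_unit_interval u) * coord n i (Rep_unit_interval u)"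
proof -
  let ?k = "\<lambda>u. cutoff n (Rep_unit_interval u) * coord n i (Rep_unit_interval u)"
  have "continuous_on UNIV ?k"
    unfolding cutoff_def coord_def density_def
    by (intro continuous_intros continuous_on_Rep_unit_interval) auto
  moreover have "norm (?k u) \<le> 1" for u
    by (simp add: abs_mult coord_bounds cutoff_bounds mult_le_one)
  ultimately have "?k \<in> bcontfun"
    by (rule bcontfun_normI)
  with assms show ?thesis
    by (simp add: piece_def Bcontfun_inverse)
qed

lemma norm_piece_le: "norm (piece n i) \<le> 1"
proof (cases "i < 2 ^ n")
  case True
  then show ?thesis
    by (intro norm_bound) (simp add: piece_apply abs_mult coord_bounds cutoff_bounds mult_le_one)
qed (simp add: piece_def)

text \<open>If the last cutoff vanishes, the sum does not grow. Otherwise even the untruncated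
  square sum is still at most 10, and cutoffs only decrease its terms.\<close>

lemma sum_cutoff_density: "(\<Sum>n<N. (cutoff n x * density n x)\<^sup>2) \<le> 10"
proof (induction N)
  case (Suc N)
  show ?case
  proof (cases "cutoff N x = 0")
    case True
    with Suc show ?thesis
      by simp
  next
    case False
    then have "(\<Sum>m\<le>N. (density m x)\<^sup>2) \<le> 10"
      by (auto simp: cutoff_def max_def min_def split: if_splits)
    moreover have "(\<Sum>n<Suc N. (cutoff n x * density n x)\<^sup>2) \<le> (\<Sum>m\<le>N. (density m x)\<^sup>2)"
      unfolding lessThan_Suc_atMost
      by (intro sum_mono power_mono)
        (auto simp: cutoff_bounds density_nonneg intro!: mult_left_le_one_le)
    ultimately show ?thesis
      by linarith
  qed
qed simp

lemma simple_function_fseq: "simple_function leb01 (fseq n)"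
proof -
  have "simple_function leb01 (\<lambda>t::real. \<lfloor>2 ^ n * t\<rfloor>)"
    unfolding simple_function_eq_measurable
  proof
    have "(\<lambda>t::real. \<lfloor>2 ^ n * t\<rfloor>) ` space leb01 \<subseteq> {0..2 ^ n}"
    proof (clarsimp simp: le_floor_iff floor_le_iff)
      fix t :: real assume "0 \<le> t" "t \<le> 1"
      then have "2 ^ n * t \<le> 2 ^ n"
        by simp
      then show "2 ^ n * t < 2 ^ n + 1"
        by linarith
    qed
    then show "finite ((\<lambda>t::real. \<lfloor>2 ^ n * t\<rfloor>) ` space leb01)"
      by (rule finite_subset) simp
    have "(\<lambda>t::real. \<lfloor>2 ^ n * t\<rfloor>) \<in> measurable borel (count_space UNIV)"
      by measurable
    then show "(\<lambda>t::real. \<lfloor>2 ^ n * t\<rfloor>) \<in> measurable leb01 (count_space UNIV)"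
      by (intro measurable_restrict_space1 measurable_completion) simp
  qed
  from simple_function_compose1[OF this, of "\<lambda>z. piece n (nat z)"] show ?thesis
    by (simp add: fseq_def[abs_def])
qed

lemma Linf_bounded_fseq: "Linf_bounded fseq"
proof -
  have L0: "fseq n \<in> L0" for n
    unfolding L0_def strongly_measurable_def
    using simple_function_fseq[of n] by (intro CollectI exI[of _ "\<lambda>_. fseq n"]) simp
  have le1: "Linf_norm (fseq n) \<le> 1" for n
    unfolding Linf_norm_def
  proof (rule esssup_I)
    show "(\<lambda>t. ereal (norm (fseq n t))) \<in> borel_measurable leb01"
      using simple_function_compose1[OF simple_function_fseq, of "\<lambda>z. ereal (norm z)"]
      by (rule borel_measurable_simple_function)
  qed (simp add: fseq_def norm_piece_le)
  then have "(SUP n. Linf_norm (fseq n)) \<le> 1"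
    by (rule SUP_least)
  then have "(SUP n. Linf_norm (fseq n)) < \<infinity>"
    by (rule le_less_trans) simp
  moreover have "Linf_norm (fseq n) < \<infinity>" for n
    using le1 by (rule le_less_trans) simp
  ultimately show ?thesis
    using L0 unfolding Linf_bounded_def Linf_def by blast
qed

section \<open>Scalar convergence in measure\<close>

lemma mean_blinfun_piece_tendsto_0:
  fixes \<phi> :: "C01 \<Rightarrow>\<^sub>L real"
  shows "(\<lambda>n. (\<Sum>i<2 ^ n. \<bar>\<phi> (piece n i)\<bar>) / 2 ^ n) \<longlonglongrightarrow> 0"
proof -
  \<comment> \<open>The signs turn the mean of absolute values into the value of
    \<open>\<phi>\<close> at a single function. As the pieces are nonnegative, that function is
    dominated by the truncated density whatever the signs are.\<close>
  define g where "g n = (1 / 2 ^ n) *\<^sub>R (\<Sum>i<2 ^ n. sgn (\<phi> (piece n i)) *\<^sub>R piece n i)" for n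
  have g: "\<phi> (g n) = (\<Sum>i<2 ^ n. \<bar>\<phi> (piece n i)\<bar>) / 2 ^ n" for n
    by (simp add: g_def blinfun.scaleR_right blinfun.sum_right abs_sgn mult.commute)
  have "\<bar>g n u\<bar> \<le> cutoff n (Rep_unit_interval u) * density n (Rep_unit_interval u)" for n u
  proof -
    interpret ev: bounded_linear "\<lambda>h :: C01. h u"
      by (rule bounded_linear_apply_bcontfun)
    have "\<bar>g n u\<bar> = \<bar>\<Sum>i<2 ^ n. sgn (\<phi> (piece n i)) * piece n i u\<bar> / 2 ^ n"
      by (simp add: g_def ev.scaleR ev.sum abs_mult)
    also have "\<bar>\<Sum>i<2 ^ n. sgn (\<phi> (piece n i)) * piece n i u\<bar> \<le> (\<Sum>i<2 ^ n. piece n i u)"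
    proof (rule order_trans[OF sum_abs], rule sum_mono)
      fix i :: nat assume "i \<in> {..<2 ^ n}"
      then have "0 \<le> piece n i u"
        by (simp add: piece_apply coord_bounds cutoff_bounds)
      then show "\<bar>sgn (\<phi> (piece n i)) * piece n i u\<bar> \<le> piece n i u"
        by (auto simp: sgn_if)
    qed
    also have "\<dots> / 2 ^ n = cutoff n (Rep_unit_interval u) * density n (Rep_unit_interval u)"
      by (simp add: piece_apply density_def sum_distrib_left)
    finally show ?thesis
      by (simp add: divide_right_mono)
  qed
  then have "(g n u)\<^sup>2 \<le> (cutoff n (Rep_unit_interval u) * density n (Rep_unit_interval u))\<^sup>2" for n u
    by (simp add: abs_le_square_iff[symmetric] cutoff_bounds density_nonneg)
  then have "(\<Sum>n<N. (g n u)\<^sup>2) \<le> 10" for N u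
    by (rule order_trans[OF sum_mono sum_cutoff_density])
  then have "(\<lambda>n. \<phi> (g n)) \<longlonglongrightarrow> 0"
    by (rule blinfun_tendsto_0_if_square_bounded)
  then show ?thesis
    by (simp add: g)
qed

text \<open>Markov's inequality for a step function on \<open>2 ^ n\<close> intervals of equal
  length.\<close>

lemma measure_fseq_le:
  fixes \<phi> :: "C01 \<Rightarrow>\<^sub>L real"
  assumes e: "e > 0"
  shows "measure leb01 {t \<in> space leb01. \<bar>\<phi> (fseq n t)\<bar> > e}
    \<le> (\<Sum>i<2 ^ n. \<bar>\<phi> (piece n i)\<bar>) / 2 ^ n / e" (is "measure _ ?S \<le> _")
proof -
  define I where "I = {i. i < 2 ^ n \<and> \<bar>\<phi> (piece n i)\<bar> > e}"
  have fin: "finite I"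
    by (simp add: I_def)
  let ?J = "\<lambda>i::nat. {real i / 2 ^ n .. real (Suc i) / 2 ^ n}"
  have sub: "?S \<subseteq> (\<Union>i\<in>I. ?J i)"
  proof
    fix t assume t: "t \<in> ?S"
    let ?i = "nat \<lfloor>2 ^ n * t\<rfloor>"
    from t have t01: "0 \<le> t" "t \<le> 1" and gt: "\<bar>\<phi> (piece n ?i)\<bar> > e"
      by (auto simp: fseq_def)
    \<comment> \<open>At \<open>t = 1\<close> the piece is 0, so its value under
      \<open>\<phi>\<close> cannot exceed \<open>e\<close>.\<close>
    have "?i < 2 ^ n"
      using gt e by (auto simp: piece_def split: if_splits)
    with gt have "?i \<in> I"
      by (simp add: I_def)
    moreover have "t \<in> ?J ?i"
    proof -
      have "real ?i = \<lfloor>2 ^ n * t\<rfloor>"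
        using t01 by simp
      then have "real ?i \<le> 2 ^ n * t" "2 ^ n * t \<le> real (Suc ?i)"
        by linarith+
      then show ?thesis
        by (simp add: field_simps)
    qed
    ultimately show "t \<in> (\<Union>i\<in>I. ?J i)"
      by blast
  qed
  have meas: "?S \<in> sets leb01"
  proof -
    have "simple_function leb01 (\<lambda>t. \<bar>\<phi> (fseq n t)\<bar>)"
      using simple_function_compose1[OF simple_function_fseq, of "\<lambda>z. \<bar>\<phi> z\<bar>"] .
    then have "(\<lambda>t. \<bar>\<phi> (fseq n t)\<bar>) \<in> borel_measurable leb01"
      by (rule borel_measurable_simple_function)
    then show ?thesis
      by measurable
  qed
  have "measure leb01 ?S = measure lebesgue ?S"
    by (rule measure_restrict_space) auto
  also have "\<dots> \<le> measure lebesgue (\<Union>i\<in>I. ?J i)"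
  proof (rule measure_mono_fmeasurable[OF sub])
    show "?S \<in> sets lebesgue"
      using meas by (subst (asm) sets_restrict_space_iff) auto
    show "(\<Union>i\<in>I. ?J i) \<in> lmeasurable"
      using fin by (intro fmeasurable.finite_UN) auto
  qed
  also have "\<dots> \<le> (\<Sum>i\<in>I. measure lebesgue (?J i))"
    using fin by (intro measure_UNION_le) auto
  also have "\<dots> = (\<Sum>i\<in>I. 1 / 2 ^ n)"
    by (intro sum.cong) (auto simp: field_simps)
  also have "\<dots> \<le> (\<Sum>i\<in>I. \<bar>\<phi> (piece n i)\<bar> / 2 ^ n / e)"
    using e by (intro sum_mono) (auto simp: I_def field_simps)
  also have "\<dots> \<le> (\<Sum>i<2 ^ n. \<bar>\<phi> (piece n i)\<bar> / 2 ^ n / e)"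
    using e by (intro sum_mono2) (auto simp: I_def)
  finally show ?thesis
    by (simp add: sum_divide_distrib)
qed

lemma fseq_converges_scalarly_in_measure: "converges_scalarly_in_measure fseq (\<lambda>_. 0)"
  unfolding converges_scalarly_in_measure_def converges_in_measure_def
proof (intro allI impI)
  fix \<phi> :: "C01 \<Rightarrow>\<^sub>L real" and e :: real
  assume e: "e > 0"
  let ?m = "\<lambda>n. measure leb01 {t \<in> space leb01. \<bar>\<phi> (fseq n t)\<bar> > e}"
  have "norm (?m n) \<le> (\<Sum>i<2 ^ n. \<bar>\<phi> (piece n i)\<bar>) / 2 ^ n / e" for n
    unfolding real_norm_def abs_of_nonneg[OF measure_nonneg] by (rule measure_fseq_le[OF e])
  moreover have "(\<lambda>n. (\<Sum>i<2 ^ n. \<bar>\<phi> (piece n i)\<bar>) / 2 ^ n / e) \<longlonglongrightarrow> 0"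
    by (rule tendsto_divide_zero) (rule mean_blinfun_piece_tendsto_0)
  ultimately have "?m \<longlonglongrightarrow> 0"
    by (rule Lim_null_comparison[OF always_eventually[OF allI]])
  then show "(\<lambda>n. measure leb01 {t \<in> space leb01. \<bar>\<phi> (fseq n t) - \<phi> 0\<bar> > e}) \<longlonglongrightarrow> 0"
    by (simp only: blinfun.zero_right diff_zero)
qed

section \<open>Failure of scalar almost everywhere convergence\<close>

text \<open>The dyadic typewriter: for \<open>k = 2 ^ j + q\<close> with \<open>q < 2 ^ j\<close>, the indices \<open>i\<close> of the
  dyadic intervals of length \<open>1 / 2 ^ n\<close> inside the \<open>q\<close>-th one of length \<open>1 / 2 ^ j\<close>.\<close>

definition typewriter :: "nat \<Rightarrow> nat \<Rightarrow> nat \<Rightarrow> bool"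
  where "typewriter k n i \<longleftrightarrow> k > 0 \<and> 2 ^ floor_log k + i div 2 ^ (n - floor_log k) = k"

text \<open>The condition fixes the quotient of \<open>i\<close> by the block length, so
  \<open>i\<close> runs through at most one block. For \<open>n < floor_log k\<close> the truncated
  subtraction gives block length 1.\<close>

lemma card_typewriter_le: "card {i. i < 2 ^ n \<and> typewriter k n i} \<le> 2 ^ (n - floor_log k)"
proof -
  let ?p = "2 ^ (n - floor_log k) :: nat" and ?q = "k - 2 ^ floor_log k"
  have "{i. i < 2 ^ n \<and> typewriter k n i} \<subseteq> {?q * ?p..<?q * ?p + ?p}"
  proof clarsimp
    fix i assume "typewriter k n i"
    then have "i div ?p = ?q"
      unfolding typewriter_def by linarith
    then have "?q * ?p + i mod ?p = i"
      using div_mult_mod_eq[of i ?p] by simp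
    moreover have "i mod ?p < ?p"
      by simp
    ultimately show "?q * ?p \<le> i \<and> i < ?q * ?p + ?p"
      by linarith
  qed
  from card_mono[OF _ this] show ?thesis
    by simp
qed

lemma sum_inverse_squares_le: "(\<Sum>k=1..n. 1 / (real k)\<^sup>2) \<le> 2"
proof -
  \<comment> \<open>The sharper bound makes the induction telescope.\<close>
  have "(\<Sum>k=1..Suc n. 1 / (real k)\<^sup>2) \<le> 2 - 1 / Suc n" for n
  proof (induction n)
    case (Suc n)
    have "1 / (real (Suc (Suc n)))\<^sup>2 \<le> 1 / Suc n - 1 / Suc (Suc n)"
    proof -
      have "1 / (real n + 1) - 1 / (real n + 2) = 1 / ((real n + 1) * (real n + 2))"
        by (simp add: field_simps)
      moreover have "1 / ((real n + 2) * (real n + 2)) \<le> 1 / ((real n + 1) * (real n + 2))"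
        by (intro divide_left_mono mult_right_mono) auto
      ultimately show ?thesis
        by (simp add: power2_eq_square add.commute)
    qed
    with Suc show ?case
      by simp
  qed simp
  note * = this
  show ?thesis
  proof (cases n)
    case (Suc m)
    have "2 - 1 / real (Suc m) \<le> 2"
      by simp
    with *[of m] show ?thesis
      unfolding Suc by linarith
  qed simp
qed

lemma ex_typewriter_point:
  fixes r :: "nat \<Rightarrow> nat"
  assumes r: "strict_mono r"
  obtains u where "\<And>k i. i < 2 ^ r k \<Longrightarrow> piece (r k) i u = of_bool (typewriter k (r k) i)"
proof -
  \<comment> \<open>Row \<open>r k\<close> of the array carries the \<open>k\<close>-th typewriter
    set and all other rows are zero; injectivity of \<open>r\<close> makes this consistent.\<close>
  define \<beta> where "\<beta> m = (case prod_decode m of (n, i) \<Rightarrow> \<exists>k. r k = n \<and> typewriter k n i)" for m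
  define x where "x = cantor_point \<beta>"
  have x01: "x \<in> {0..1}"
    by (simp add: x_def cantor_point_bounds)
  have coord: "coord n i x = of_bool (\<exists>k. r k = n \<and> typewriter k n i)" for n i
    by (simp add: coord_def x_def bump_cantor_point \<beta>_def)
  have coord_r: "coord (r k) i x = of_bool (typewriter k (r k) i)" for k i
    using r by (simp add: coord strict_mono_eq)
  have dens_r: "density (r k) x \<le> 2 / real k" if k: "k > 0" for k
  proof -
    let ?j = "floor_log k"
    \<comment> \<open>The level must not exceed \<open>r k\<close>, so that the exponent
      \<open>r k - ?j\<close> is a true difference.\<close>
    have "?j < 2 ^ ?j"
      by simp
    also have "\<dots> \<le> k"
      using k by (rule floor_log_exp2_le)
    also have "k \<le> r k"
      using r by (rule strict_mono_imp_increasing)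
    finally have j: "?j \<le> r k"
      by simp
    have "(\<Sum>i<2 ^ r k. coord (r k) i x) = card {i. i < 2 ^ r k \<and> typewriter k (r k) i}"
      by (simp add: coord_r of_bool_def sum.If_cases Int_def)
    also have "\<dots> \<le> real (2 ^ (r k - ?j))"
      using card_typewriter_le by (rule of_nat_mono)
    finally have "density (r k) x \<le> 2 ^ (r k - ?j) / 2 ^ r k"
      by (simp add: density_def divide_right_mono)
    also have "\<dots> = 1 / 2 ^ ?j"
      using j by (simp add: power_diff)
    also have "\<dots> \<le> 2 / real k"
    proof -
      have "real k \<le> real (2 * 2 ^ ?j)"
        using floor_log_exp2_ge by (rule of_nat_mono)
      with k show ?thesis
        by (simp add: field_simps)
    qed
    finally show ?thesis .
  qed
  \<comment> \<open>Row \<open>r 0\<close> is zero as well, since the typewriter set for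
    \<open>k = 0\<close> is empty.\<close>
  have dens_0: "density n x = 0" if "n \<notin> r ` {1..}" for n
  proof -
    have "coord n i x = 0" for i
      using that by (auto simp: coord typewriter_def image_iff)
    then show ?thesis
      by (simp add: density_def)
  qed
  have sum_le: "(\<Sum>m\<le>n. (density m x)\<^sup>2) \<le> 8" for n
  proof -
    have "(\<Sum>m\<le>n. (density m x)\<^sup>2) = (\<Sum>m\<in>{..n} \<inter> r ` {1..}. (density m x)\<^sup>2)"
      by (rule sum.mono_neutral_right) (auto simp: dens_0)
    also have "\<dots> \<le> (\<Sum>m\<in>r ` {1..n}. (density m x)\<^sup>2)"
    proof (rule sum_mono2)
      show "{..n} \<inter> r ` {1..} \<subseteq> r ` {1..n}"
      proof clarsimp
        fix k assume "r k \<le> n" "Suc 0 \<le> k"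
        with strict_mono_imp_increasing[OF r, of k] show "r k \<in> r ` {Suc 0..n}"
          by simp
      qed
    qed auto
    also have "\<dots> = (\<Sum>k=1..n. (density (r k) x)\<^sup>2)"
      using r by (subst sum.reindex) (auto simp: strict_mono_imp_inj_on)
    also have "\<dots> \<le> (\<Sum>k=1..n. (2 / real k)\<^sup>2)"
      by (intro sum_mono power_mono) (auto simp: dens_r density_nonneg)
    also have "\<dots> = 4 * (\<Sum>k=1..n. 1 / (real k)\<^sup>2)"
      by (simp add: sum_distrib_left power_divide)
    also have "\<dots> \<le> 8"
      using sum_inverse_squares_le[of n] by simp
    finally show ?thesis .
  qed
  \<comment> \<open>The square sum 8 stays below 9, so the truncation is inactive at
    \<open>x\<close>.\<close>
  have cut: "cutoff n x = 1" for n
    using sum_le[of n] by (simp add: cutoff_def)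
  show thesis
    by (rule that[of "Abs_unit_interval x"])
      (simp add: piece_apply Abs_unit_interval_inverse[OF x01] cut coord_r)
qed

text \<open>Dividing the level-\<open>n\<close> dyadic index of \<open>t\<close> by
  \<open>2 ^ (n - j)\<close> gives its level-\<open>j\<close> index, and \<open>q < 2 ^ j\<close>
  lets \<open>floor_log\<close> recover \<open>j\<close>.\<close>

lemma typewriter_eq_nat_floor:
  fixes t :: real
  assumes t: "0 \<le> t" "t < 1" and j: "j \<le> n" and q: "q < 2 ^ j"
  shows "typewriter (2 ^ j + q) n (nat \<lfloor>2 ^ n * t\<rfloor>) \<longleftrightarrow> nat \<lfloor>2 ^ j * t\<rfloor> = q"
proof -
  have j': "floor_log (2 ^ j + q) = j"
    using q by (intro floor_log_eqI) auto
  have "(2::real) ^ n = 2 ^ (n - j) * 2 ^ j"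
    using j by (simp flip: power_add)
  then have "2 ^ n * t / real_of_int (2 ^ (n - j)) = 2 ^ j * t"
    by simp
  then have "\<lfloor>2 ^ n * t\<rfloor> div 2 ^ (n - j) = \<lfloor>2 ^ j * t\<rfloor>"
    using floor_divide_real_eq_div[of "2 ^ (n - j)" "2 ^ n * t"] by simp
  then have "nat \<lfloor>2 ^ n * t\<rfloor> div 2 ^ (n - j) = nat \<lfloor>2 ^ j * t\<rfloor>"
    using t by (simp add: nat_div_distrib nat_power_eq flip: \<open>_ = \<lfloor>2 ^ j * t\<rfloor>\<close>)
  then show ?thesis
    by (simp add: typewriter_def j')
qed

lemma nat_floor_less:
  fixes t :: real
  assumes "0 \<le> t" "t < 1"
  shows "nat \<lfloor>2 ^ n * t\<rfloor> < 2 ^ n"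
proof -
  have "2 ^ n * t < 2 ^ n"
    using assms by simp
  then have "\<lfloor>2 ^ n * t\<rfloor> < 2 ^ n"
    by (simp add: floor_less_iff)
  then show ?thesis
    using assms by (simp add: nat_less_iff)
qed

lemma typewriter_not_convergent:
  fixes r :: "nat \<Rightarrow> nat" and t :: real
  assumes r: "strict_mono r" and t: "0 \<le> t" "t < 1"
  shows "\<not> (\<lambda>k. of_bool (typewriter k (r k) (nat \<lfloor>2 ^ r k * t\<rfloor>)) :: real) \<longlonglongrightarrow> l"
    (is "\<not> ?w \<longlonglongrightarrow> l")
proof
  assume lim: "?w \<longlonglongrightarrow> l"
  define hit where "hit j = nat \<lfloor>2 ^ j * t\<rfloor>" for j
  \<comment> \<open>Any index other than \<open>hit j\<close> would do.\<close>
  define miss where "miss j = (if hit j = 0 then 1 else 0 :: nat)" for j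
  have w: "?w (2 ^ j + q) = of_bool (hit j = q)" if "q < 2 ^ j" for j q
  proof -
    have "j \<le> 2 ^ j + q"
      using less_exp[of j] by linarith
    also have "\<dots> \<le> r (2 ^ j + q)"
      using r by (rule strict_mono_imp_increasing)
    finally show ?thesis
      using that t by (simp add: typewriter_eq_nat_floor hit_def)
  qed
  \<comment> \<open>Levels start at 1: level 0 has a single interval and leaves no room for a miss.
    Hits give the constant 1 along one subsequence, misses the constant 0 along another.\<close>
  have along: "(\<lambda>j. ?w (2 ^ Suc j + q j)) \<longlonglongrightarrow> l" if "\<And>j. q j < 2 ^ Suc j" for q
  proof -
    have "filterlim (\<lambda>j. 2 ^ Suc j + q j) at_top sequentially"
    proof (rule filterlim_at_top_mono[OF filterlim_ident], rule always_eventually, rule allI)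
      show "j \<le> 2 ^ Suc j + q j" for j
        using less_exp[of "Suc j"] by linarith
    qed
    from filterlim_compose[OF lim this] show ?thesis .
  qed
  have hit_less: "hit j < 2 ^ j" for j
    unfolding hit_def using t by (rule nat_floor_less)
  have miss_less: "miss (Suc j) < 2 ^ Suc j" for j
    using less_exp[of "Suc j"] by (simp add: miss_def)
  have "(\<lambda>j::nat. 1::real) \<longlonglongrightarrow> l"
    using along[of "\<lambda>j. hit (Suc j)", OF hit_less] by (simp only: w[OF hit_less]) simp
  moreover have "hit j \<noteq> miss j" for j
    by (simp add: miss_def)
  then have "(\<lambda>j::nat. 0::real) \<longlonglongrightarrow> l"
    using along[of "\<lambda>j. miss (Suc j)", OF miss_less] by (simp only: w[OF miss_less]) simp
  ultimately show False
    by (simp add: LIMSEQ_const_iff)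
qed

lemma fseq_subseq_not_converges_scalarly_ae:
  assumes r: "strict_mono r"
  shows "\<not> converges_scalarly_ae (fseq \<circ> r) h"
proof
  assume conv: "converges_scalarly_ae (fseq \<circ> r) h"
  from ex_typewriter_point[OF r] obtain u
    where u: "\<And>k i. i < 2 ^ r k \<Longrightarrow> piece (r k) i u = of_bool (typewriter k (r k) i)"
    by blast
  \<comment> \<open>Only the evaluation functional at \<open>u\<close> is used; whatever
    \<open>h\<close> is, it yields a scalar candidate limit at almost every
    \<open>t\<close>.\<close>
  have "AE t in leb01. (\<lambda>k. fseq (r k) t u) \<longlonglongrightarrow> h t u"
    using conv[unfolded converges_scalarly_ae_def, rule_format, of "Blinfun (\<lambda>g :: C01. g u)"]
    by (simp add: bounded_linear_Blinfun_apply[OF bounded_linear_apply_bcontfun])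
  then have "AE t in lebesgue. t \<in> {0..1} \<longrightarrow> (\<lambda>k. fseq (r k) t u) \<longlonglongrightarrow> h t u"
    by (subst (asm) AE_restrict_space_iff) auto
  moreover have "\<not> (\<lambda>k. fseq (r k) t u) \<longlonglongrightarrow> h t u" if "0 \<le> t" "t < 1" for t
    unfolding fseq_def u[OF nat_floor_less[OF that]]
    by (rule typewriter_not_convergent[OF r that])
  ultimately have "AE t in lebesgue. t \<notin> {0..<1::real}"
    by (elim eventually_mono) auto
  then have "{0..<1::real} \<in> null_sets lebesgue"
    by (subst AE_iff_null_sets) auto
  then show False
    by (simp add: null_sets_def)
qed

theorem theorem3p8:
  shows "\<not> property_D_inf TYPE(C01)"
proof -
  have "(\<lambda>_. 0) \<in> (L0 :: (real \<Rightarrow> C01) set)"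
    unfolding L0_def strongly_measurable_def
    by (intro CollectI exI[of _ "\<lambda>_ _. 0"]) simp
  then show ?thesis
    unfolding property_D_inf_def
    using Linf_bounded_fseq fseq_converges_scalarly_in_measure
      fseq_subseq_not_converges_scalarly_ae by blast
qed

end
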